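(* There exists a non-erasing stack automaton (NESA) (and hence a stack automaton (SA)) $M$ which accepts a non-regular language such that $\sigma^{\rm w}_M(n)$, $\sigma^{\rm a}_M(n)$, and $\sigma^{\rm s}_M(n)$ are all in $\Theta(\sqrt{n})$.
   Context: **Stack automata.** A one-way nondeterministic stack automaton (SA) is a 6-tuple $M=(Q,\Sigma,\Gamma,\delta,q_0,F)$: $Q$ is a finite set of states; $\Sigma,\Gamma$ are the (finite) input and stack alphabets; $\Gamma$ contains two special symbols $\triangleright$ (bottom marker) and $\triangleleft$ (top marker), and $\Gamma_0=\Gamma\setminus\{\triangleright,\triangleleft\}$; $q_0\in Q$ is the initial state; $F\subseteq Q$ is the set of final states; $\delta$ is a nondeterministic transition function from $Q\times(\Sigma\cup\{\lambda\})\times\Gamma$ into subsets of $Q\times\{\mathtt{stay},\mathtt{push}(x),\mathtt{pop},-1,0,+1 \mid x\in\Gamma_0\}$ ($\lambda$ is the empty word). Write $(q,a,y)\to(p,\iota)$ for $(p,\iota)\in\delta(q,a,y)$. An SA is non-erasing (NESA) if it has no $\mathtt{pop}$ transitions. A configuration is a triple $c=(q,w,\gamma)$ with $q\in Q$ the current state, $w\in\Sigma^*$ the remaining input, and $\gamma\in \triangleright\Gamma_0^*\uparrow\Gamma_0^*\triangleleft$ or $\gamma\in\triangleright\Gamma_0^*\triangleleft\uparrow$, where $\uparrow\notin\Gamma$ marks the stack head, which scans the symbol directly preceding it. The stack size of $c$ is $\|c\|_\Gamma=|\gamma|-3$ (number of symbols of $\Gamma_0$ on the stack). Write relation $\vdash_w$: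 if $(q,a,x)\to(p,\iota)$ with $x\in\Gamma_0\cup\{\triangleright\}$, $a\in\Sigma\cup\{\lambda\}$, then for $u\in\Sigma^*$ and $\gamma x\triangleleft\in\triangleright\Gamma_0^*\triangleleft$: $(q,au,\gamma x\uparrow\triangleleft)\vdash_w(p,u,\gamma x\uparrow\triangleleft)$ if $\iota=\mathtt{stay}$; $(q,au,\gamma x\uparrow\triangleleft)\vdash_w(p,u,\gamma xy\uparrow\triangleleft)$ if $\iota=\mathtt{push}(y)$; $(q,au,\gamma x\uparrow\triangleleft)\vdash_w(p,u,\gamma\uparrow\triangleleft)$ if $\iota=\mathtt{pop}$ and $x\ne\triangleright$. (These moves are undefined if the head is not at the topmost stack symbol.) Read relation $\vdash_r$: if $(q,a,x)\to(p,\iota)$ with $x\in\Gamma$, then for $u\in\Sigma^*$ and $\gamma_1x\gamma_2\in\triangleright\Gamma_0^*\triangleleft$: $(q,au,\gamma_1x\uparrow\gamma_2)\vdash_r(p,u,\gamma_1\uparrow x\gamma_2)$ if $\iota=-1$ and $x\neq\triangleright$; $(q,au,\gamma_1x\uparrow\gamma_2)\vdash_r(p,u,\gamma_1x\uparrow\gamma_2)$ if $\iota=0$; $(q,au,\gamma_1x\uparrow\gamma_2)\vdash_r(p,u,\gamma_1xy\uparrow\gamma_2')$ if $\iota=+1$ and $\gamma_2=y\gamma_2'$, $y\in\Gamma$. Let $\vdash=\vdash_w\cup\vdash_r$. A partial computation on $u\in\Sigma^*$ is a finite sequence of configurations $c_0\vdash\cdots\vdash c_m$ with $c_0=(q_0,u,\triangleright\uparrow\triangleleft)$.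 It is a computation if the remaining input in $c_m$ is $\lambda$, and an accepting computation if moreover the state of $c_m$ is in $F$. Its stack size is $\|\mathcal C\|_\Gamma=\max_j\|c_j\|_\Gamma$. The accepted language $L(M)$ is the set of words on which $M$ has an accepting computation. **Space measures.** For $u\in\Sigma^*$: (weak) $\sigma^{\rm w}_M(u)$ is the minimum of $\|\mathcal C\|_\Gamma$ over accepting computations of $M$ on $u$ if $u\in L(M)$, and $0$ otherwise; (accept) $\sigma^{\rm a}_M(u)$ is the maximum of $\|\mathcal C\|_\Gamma$ over accepting computations of $M$ on $u$ if $u\in L(M)$ and this maximum exists, $\infty$ if $u\in L(M)$ and $M$ has accepting computations on $u$ of arbitrarily large stack size, and $0$ if $u\notin L(M)$; (strong) $\sigma^{\rm s}_M(u)$ is the maximum of $\|\mathcal C\|_\Gamma$ over all partial computations of $M$ on $u$ if it exists, and $\infty$ otherwise. For $z\in\{{\rm w},{\rm a},{\rm s}\}$, $\sigma^z_M(n)=\max\{\sigma^z_M(u)\mid u\in\Sigma^*,|u|=n\}$. Convention: if $\sigma^z_M$ takes the value $\infty$ even for a single word, then $\sigma^z_M(n)$ is regarded as not being in $O(f(n))$ for any integer function $f$. *)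

theory Defs
  imports Complex_Main "HOL-Library.Extended_Nat" "HOL-Library.Landau_Symbols"
begin

section \<open>One-way nondeterministic stack automata\<close>

datatype 'g stack_sym = Bot | Top | Sym 'g

text \<open>
  The constructors \<open>Left\<close>, \<open>NoMove\<close>, \<open>Right\<close> are the head moves $-1$, $0$, $+1$.
\<close>

datatype 'g instr = Stay | Push 'g | Pop | Left | NoMove | Right

text \<open>
  Only the ordinary stack symbols $\Gamma_0$ are a component of the record; the full stack
  alphabet $\Gamma$ is \<open>stack_alphabet\<close> below. In \<open>delta\<close>, the value \<open>None\<close> stands for the
  empty word $\lambda$ in the input position.
\<close>

record ('q, 'a, 'g) stack_automaton =
  states :: "'q set"
  input_alphabet :: "'a set"
  stack_alphabet0 :: "'g set"
  delta :: "'q \<Rightarrow> 'a option \<Rightarrow> 'g stack_sym \<Rightarrow> ('q \<times> 'g instr) set"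
  init :: 'q
  finals :: "'q set"

definition stack_alphabet :: "('q, 'a, 'g) stack_automaton \<Rightarrow> 'g stack_sym set" where
  "stack_alphabet M = {Bot, Top} \<union> Sym ` stack_alphabet0 M"

definition input_labels :: "('q, 'a, 'g) stack_automaton \<Rightarrow> 'a option set" where
  "input_labels M = {None} \<union> Some ` input_alphabet M"

definition instructions :: "('q, 'a, 'g) stack_automaton \<Rightarrow> 'g instr set" where
  "instructions M = {Stay, Pop, Left, NoMove, Right} \<union> Push ` stack_alphabet0 M"

definition SA :: "('q, 'a, 'g) stack_automaton \<Rightarrow> bool" where
  "SA M \<longleftrightarrow>
     finite (states M) \<and> finite (input_alphabet M) \<and> finite (stack_alphabet0 M) \<and>
     init M \<in> states M \<and> finals M \<subseteq> states M \<and>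
     (\<forall>q \<in> states M. \<forall>a \<in> input_labels M. \<forall>y \<in> stack_alphabet M.
        delta M q a y \<subseteq> states M \<times> instructions M)"

text \<open>
  The function \<open>delta\<close> is total on its type, so its values outside the proper domain are
  ignored here.
\<close>

definition transition ::
  "('q, 'a, 'g) stack_automaton \<Rightarrow> 'q \<Rightarrow> 'a option \<Rightarrow> 'g stack_sym \<Rightarrow> 'q \<Rightarrow> 'g instr \<Rightarrow> bool" where
  "transition M q a y p i \<longleftrightarrow>
     q \<in> states M \<and> a \<in> input_labels M \<and> y \<in> stack_alphabet M \<and> (p, i) \<in> delta M q a y"

definition NESA :: "('q, 'a, 'g) stack_automaton \<Rightarrow> bool" where
  "NESA M \<longleftrightarrow> SA M \<and> (\<forall>q a y p. \<not> transition M q a y p Pop)"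


section \<open>Configurations and moves\<close>

text \<open>
  A configuration is a tuple \<open>(q, w, l, r)\<close>, where \<open>l\<close> and \<open>r\<close> are the parts of the stack
  word before and after the head marker, both in left-to-right order; the head scans the
  last symbol of \<open>l\<close>.
\<close>

type_synonym ('q, 'a, 'g) config = "'q \<times> 'a list \<times> 'g stack_sym list \<times> 'g stack_sym list"

definition stack_words :: "('q, 'a, 'g) stack_automaton \<Rightarrow> 'g stack_sym list set" where
  "stack_words M = {[Bot] @ map Sym v @ [Top] | v. v \<in> lists (stack_alphabet0 M)}"

text \<open>Both end markers are discounted; the head marker is not part of \<open>l\<close> and \<open>r\<close>.\<close>

fun stack_size :: "('q, 'a, 'g) config \<Rightarrow> nat" where
  "stack_size (q, w, l, r) = length l + length r - 2"

fun label_word :: "'a option \<Rightarrow> 'a list" where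
  "label_word None = []"
| "label_word (Some a) = [a]"

inductive write_step ::
  "('q, 'a, 'g) stack_automaton \<Rightarrow> ('q, 'a, 'g) config \<Rightarrow> ('q, 'a, 'g) config \<Rightarrow> bool"
  for M where
  stay: "\<lbrakk>transition M q a x p Stay; x \<noteq> Top; u \<in> lists (input_alphabet M);
          g @ [x] @ [Top] \<in> stack_words M\<rbrakk> \<Longrightarrow>
         write_step M (q, label_word a @ u, g @ [x], [Top]) (p, u, g @ [x], [Top])"
| push: "\<lbrakk>transition M q a x p (Push y); x \<noteq> Top; u \<in> lists (input_alphabet M);
          g @ [x] @ [Top] \<in> stack_words M\<rbrakk> \<Longrightarrow>
         write_step M (q, label_word a @ u, g @ [x], [Top]) (p, u, g @ [x, Sym y], [Top])"
| pop:  "\<lbrakk>transition M q a x p Pop; x \<noteq> Top; x \<noteq> Bot; u \<in> lists (input_alphabet M);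
          g @ [x] @ [Top] \<in> stack_words M\<rbrakk> \<Longrightarrow>
         write_step M (q, label_word a @ u, g @ [x], [Top]) (p, u, g, [Top])"

inductive read_step ::
  "('q, 'a, 'g) stack_automaton \<Rightarrow> ('q, 'a, 'g) config \<Rightarrow> ('q, 'a, 'g) config \<Rightarrow> bool"
  for M where
  left:    "\<lbrakk>transition M q a x p Left; x \<noteq> Bot; u \<in> lists (input_alphabet M);
             g1 @ [x] @ g2 \<in> stack_words M\<rbrakk> \<Longrightarrow>
            read_step M (q, label_word a @ u, g1 @ [x], g2) (p, u, g1, x # g2)"
| no_move: "\<lbrakk>transition M q a x p NoMove; u \<in> lists (input_alphabet M);
             g1 @ [x] @ g2 \<in> stack_words M\<rbrakk> \<Longrightarrow>
            read_step M (q, label_word a @ u, g1 @ [x], g2) (p, u, g1 @ [x], g2)"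
| right:   "\<lbrakk>transition M q a x p Right; u \<in> lists (input_alphabet M);
             g1 @ [x] @ g2 \<in> stack_words M; g2 = y # g2'\<rbrakk> \<Longrightarrow>
            read_step M (q, label_word a @ u, g1 @ [x], g2) (p, u, g1 @ [x, y], g2')"

definition step ::
  "('q, 'a, 'g) stack_automaton \<Rightarrow> ('q, 'a, 'g) config \<Rightarrow> ('q, 'a, 'g) config \<Rightarrow> bool" where
  "step M c d \<longleftrightarrow> write_step M c d \<or> read_step M c d"


section \<open>Computations and accepted language\<close>

definition partial_computation ::
  "('q, 'a, 'g) stack_automaton \<Rightarrow> 'a list \<Rightarrow> ('q, 'a, 'g) config list \<Rightarrow> bool" where
  "partial_computation M u C \<longleftrightarrow>
     u \<in> lists (input_alphabet M) \<and> C \<noteq> [] \<and>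
     hd C = (init M, u, [Bot], [Top]) \<and> successively (step M) C"

definition computation ::
  "('q, 'a, 'g) stack_automaton \<Rightarrow> 'a list \<Rightarrow> ('q, 'a, 'g) config list \<Rightarrow> bool" where
  "computation M u C \<longleftrightarrow> partial_computation M u C \<and> fst (snd (last C)) = []"

definition accepting_computation ::
  "('q, 'a, 'g) stack_automaton \<Rightarrow> 'a list \<Rightarrow> ('q, 'a, 'g) config list \<Rightarrow> bool" where
  "accepting_computation M u C \<longleftrightarrow> computation M u C \<and> fst (last C) \<in> finals M"

definition computation_size :: "('q, 'a, 'g) config list \<Rightarrow> nat" where
  "computation_size C = Max (stack_size ` set C)"

definition language :: "('q, 'a, 'g) stack_automaton \<Rightarrow> 'a list set" where
  "language M = {u \<in> lists (input_alphabet M). \<exists>C. accepting_computation M u C}"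


section \<open>Regular languages\<close>

text \<open>
  Languages accepted by deterministic finite automata. Taking the states to be natural
  numbers is no restriction, because the state set is finite.
\<close>

definition regular_language :: "'a set \<Rightarrow> 'a list set \<Rightarrow> bool" where
  "regular_language A L \<longleftrightarrow>
     (\<exists>(Q :: nat set) d q0 F.
        finite Q \<and> q0 \<in> Q \<and> F \<subseteq> Q \<and> (\<forall>q \<in> Q. \<forall>a \<in> A. d q a \<in> Q) \<and>
        L = {w \<in> lists A. foldl d q0 w \<in> F})"


section \<open>Space measures\<close>

text \<open>
  The supremum of a nonempty set of (embedded) natural numbers in \<^typ>\<open>enat\<close> is its maximum
  if the set is bounded, and \<open>\<infinity>\<close> otherwise.
\<close>

definition weak_space_word :: "('q, 'a, 'g) stack_automaton \<Rightarrow> 'a list \<Rightarrow> enat" where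
  "weak_space_word M u =
     (if u \<in> language M
      then INF C \<in> {C. accepting_computation M u C}. enat (computation_size C) else 0)"

definition accept_space_word :: "('q, 'a, 'g) stack_automaton \<Rightarrow> 'a list \<Rightarrow> enat" where
  "accept_space_word M u =
     (if u \<in> language M
      then SUP C \<in> {C. accepting_computation M u C}. enat (computation_size C) else 0)"

definition strong_space_word :: "('q, 'a, 'g) stack_automaton \<Rightarrow> 'a list \<Rightarrow> enat" where
  "strong_space_word M u =
     (SUP C \<in> {C. partial_computation M u C}. enat (computation_size C))"

definition max_over_length ::
  "('q, 'a, 'g) stack_automaton \<Rightarrow> ('a list \<Rightarrow> enat) \<Rightarrow> nat \<Rightarrow> enat" where
  "max_over_length M s n = (SUP u \<in> {u \<in> lists (input_alphabet M). length u = n}. s u)"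

definition weak_space :: "('q, 'a, 'g) stack_automaton \<Rightarrow> nat \<Rightarrow> enat" where
  "weak_space M = max_over_length M (weak_space_word M)"

definition accept_space :: "('q, 'a, 'g) stack_automaton \<Rightarrow> nat \<Rightarrow> enat" where
  "accept_space M = max_over_length M (accept_space_word M)"

definition strong_space :: "('q, 'a, 'g) stack_automaton \<Rightarrow> nat \<Rightarrow> enat" where
  "strong_space M = max_over_length M (strong_space_word M)"

text \<open>
  A measure that takes the value \<open>\<infinity>\<close> anywhere belongs to no class \<open>O(f)\<close>, hence to no
  class \<open>\<Theta>(f)\<close>.
\<close>

definition space_in_bigtheta :: "(nat \<Rightarrow> enat) \<Rightarrow> (nat \<Rightarrow> real) \<Rightarrow> bool" where
  "space_in_bigtheta s f \<longleftrightarrow>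
     (\<forall>n. s n \<noteq> \<infinity>) \<and> (\<lambda>n. real (the_enat (s n))) \<in> \<Theta>(f)"

end

theory Submission
  imports Defs "HOL-Library.Discrete_Functions"
begin

text \<open>
  The automaton is deterministic, reads one letter in every move, and has only final states.
  With \<open>k\<close> symbols on the stack, it walks from the topmost symbol down to the bottom marker,
  back up to the top marker, and one step left to the topmost symbol, reading \<open>0\<close> each time; then
  it pushes a symbol, reading \<open>1\<close>. Such a phase takes \<open>2 k + 3\<close> letters, so the phases with
  \<open>0, \<dots>, k - 1\<close> symbols take \<open>(k + 1)\<^sup>2 - 1\<close> letters together, and after \<open>n\<close> letters the stack
  size is \<open>\<lfloor>sqrt (n + 1)\<rfloor> - 1\<close>. The accepted words are the prefixes of one infinite word,
  whose \<open>n\<close>-th letter (from \<open>0\<close>) is \<open>1\<close> iff \<open>n + 2\<close> is a square. Hence all three space measures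
  agree, and the language is not regular since the word is not ultimately periodic.
\<close>

section \<open>The automaton and its moves\<close>

definition sqrt_rules :: "(nat \<times> nat \<times> nat stack_sym \<times> nat \<times> nat instr) set" where
  "sqrt_rules = {(0, 0, Sym 0, 0, Left), (0, 0, Bot, 1, Right),
                 (1, 0, Sym 0, 1, Right), (1, 0, Top, 2, Left),
                 (2, 1, Bot, 0, Push 0), (2, 1, Sym 0, 0, Push 0)}"

text \<open>State \<open>0\<close> walks down to the bottom marker, state \<open>1\<close> walks up
  to the top marker, and state \<open>2\<close>, back on the topmost symbol, pushes.\<close>

definition sqrt_nesa :: "(nat, nat, nat) stack_automaton" where
  "sqrt_nesa = \<lparr>states = {0, 1, 2}, input_alphabet = {0, 1}, stack_alphabet0 = {0},
     delta = \<lambda>q a y. {(p, i). \<exists>c. a = Some c \<and> (q, c, y, p, i) \<in> sqrt_rules},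
     init = 0, finals = {0, 1, 2}\<rparr>"

lemma sqrt_nesa_simps [simp]:
  "states sqrt_nesa = {0, 1, 2}" "input_alphabet sqrt_nesa = {0, 1}"
  "stack_alphabet0 sqrt_nesa = {0}" "init sqrt_nesa = 0" "finals sqrt_nesa = {0, 1, 2}"
  by (simp_all add: sqrt_nesa_def)

lemma transition_sqrt_nesa:
  "transition sqrt_nesa q a y p i \<longleftrightarrow> (\<exists>c. a = Some c \<and> (q, c, y, p, i) \<in> sqrt_rules)"
  unfolding transition_def
  by (auto simp: sqrt_nesa_def sqrt_rules_def input_labels_def stack_alphabet_def)

lemma NESA_sqrt_nesa: "NESA sqrt_nesa"
  unfolding NESA_def SA_def transition_sqrt_nesa
  by (auto simp: sqrt_rules_def instructions_def sqrt_nesa_def)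

text \<open>Inverting the move rules once for all automata makes the successors of a configuration
  computable by simplification. The stack word hypothesis supplies the well-formedness premise
  shared by all rules.\<close>

lemma step_snoc_iff:
  assumes "l @ [x] @ r \<in> stack_words M"
  shows "step M (q, u, l @ [x], r) d \<longleftrightarrow>
    (\<exists>a v p i. transition M q a x p i \<and> u = label_word a @ v \<and> v \<in> lists (input_alphabet M) \<and>
      (case i of
         Stay \<Rightarrow> x \<noteq> Top \<and> r = [Top] \<and> d = (p, v, l @ [x], r)
       | Push y \<Rightarrow> x \<noteq> Top \<and> r = [Top] \<and> d = (p, v, l @ [x, Sym y], r)
       | Pop \<Rightarrow> x \<noteq> Top \<and> x \<noteq> Bot \<and> r = [Top] \<and> d = (p, v, l, r)
       | Left \<Rightarrow> x \<noteq> Bot \<and> d = (p, v, l, x # r)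
       | NoMove \<Rightarrow> d = (p, v, l @ [x], r)
       | Right \<Rightarrow> r \<noteq> [] \<and> d = (p, v, l @ [x, hd r], tl r)))"
    (is "_ \<longleftrightarrow> ?R")
proof
  assume "step M (q, u, l @ [x], r) d"
  then show ?R
    unfolding step_def
    by (elim disjE write_step.cases read_step.cases) (fastforce+)
next
  assume ?R
  then obtain a v p i where t: "transition M q a x p i" and u: "u = label_word a @ v"
    and v: "v \<in> lists (input_alphabet M)" and i: "case i of
         Stay \<Rightarrow> x \<noteq> Top \<and> r = [Top] \<and> d = (p, v, l @ [x], r)
       | Push y \<Rightarrow> x \<noteq> Top \<and> r = [Top] \<and> d = (p, v, l @ [x, Sym y], r)
       | Pop \<Rightarrow> x \<noteq> Top \<and> x \<noteq> Bot \<and> r = [Top] \<and> d = (p, v, l, r)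
       | Left \<Rightarrow> x \<noteq> Bot \<and> d = (p, v, l, x # r)
       | NoMove \<Rightarrow> d = (p, v, l @ [x], r)
       | Right \<Rightarrow> r \<noteq> [] \<and> d = (p, v, l @ [x, hd r], tl r)"
    by blast
  show "step M (q, u, l @ [x], r) d"
    using t v i assms unfolding step_def u
    by (cases i) (auto intro: write_step.intros read_step.intros simp: neq_Nil_conv)
qed

section \<open>Moves within one phase\<close>

text \<open>
  The configuration after \<open>t \<le> 2 k + 2\<close> letters of the phase that starts with \<open>k\<close> symbols on
  the stack.
\<close>

definition phase_conf :: "nat \<Rightarrow> nat \<Rightarrow> nat list \<Rightarrow> (nat, nat, nat) config" where
  "phase_conf k t u =
    (if t \<le> k then (0, u, Bot # replicate (k - t) (Sym 0), replicate t (Sym 0) @ [Top])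
     else if t \<le> 2 * k then (1, u, Bot # replicate (t - k) (Sym 0), replicate (2 * k - t) (Sym 0) @ [Top])
     else if t = 2 * k + 1 then (1, u, Bot # replicate k (Sym 0) @ [Top], [])
     else (2, u, Bot # replicate k (Sym 0), [Top]))"

lemma stack_words_sqrt_nesa [simp]:
  "Bot # replicate k (Sym 0) @ [Top] \<in> stack_words sqrt_nesa"
  unfolding stack_words_def by (auto intro!: exI[of _ "replicate k 0"])

text \<open>In every configuration of a phase, the state and the scanned symbol match exactly one
  rule, so both the letter and the successor are forced. The cases separate the walk down, the
  bottom marker, the walk up, the top marker and the push.\<close>

lemma step_phase_conf:
  assumes "t \<le> 2 * k + 2"
  shows "step sqrt_nesa (phase_conf k t u) d \<longleftrightarrow>
    (\<exists>v. u = (if t = 2 * k + 2 then 1 else 0) # v \<and> v \<in> lists {0, 1} \<and>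
         d = (if t = 2 * k + 2 then phase_conf (Suc k) 0 v else phase_conf k (Suc t) v))"
proof -
  note step = step_snoc_iff[of _ _ _ sqrt_nesa, unfolded transition_sqrt_nesa]
  have snoc: "replicate (Suc m) (Sym 0) = replicate m (Sym 0) @ [Sym (0::nat)]" for m
    by (simp add: replicate_append_same)
  \<comment> \<open>The push is split by \<open>k = 0\<close> because the topmost symbol is then
    \<open>Bot\<close>, which has its own rule.\<close>
  consider "t < k" | "t = k" | "k < t" "t \<le> 2 * k" | "t = 2 * k + 1" | "t = 2 * k + 2" "k = 0"
    | "t = 2 * k + 2" "k > 0"
    using assms by linarith
  then show ?thesis
  proof cases
    case 1
    define m where "m = k - t - 1"
    have k: "k = t + Suc m" using 1 by (simp add: m_def)
    have w: "(Bot # replicate m (Sym 0)) @ [Sym 0] @ (replicate t (Sym 0) @ [Top])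
        \<in> stack_words sqrt_nesa"
      using stack_words_sqrt_nesa[of "m + 1 + t"] by (simp add: replicate_add replicate_app_Cons_same)
    have c: "phase_conf k t u = (0, u, (Bot # replicate m (Sym 0)) @ [Sym 0], replicate t (Sym 0) @ [Top])"
      unfolding phase_conf_def k by (simp add: replicate_append_same)
    show ?thesis
      unfolding c step[OF w]
      by (auto simp: sqrt_rules_def phase_conf_def k)
  next
    case 2
    have w: "[] @ [Bot] @ (replicate k (Sym 0) @ [Top]) \<in> stack_words sqrt_nesa"
      by simp
    have c: "phase_conf k t u = (0, u, [] @ [Bot], replicate k (Sym 0) @ [Top])"
      unfolding phase_conf_def using 2 by simp
    show ?thesis
      unfolding c step[OF w] using 2
      \<comment> \<open>Moving right from \<open>Bot\<close> already reaches \<open>Top\<close> if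
        \<open>k = 0\<close>.\<close>
      by (cases k) (auto simp: sqrt_rules_def phase_conf_def)
  next
    case 3
    define m where "m = t - k - 1"
    define r where "r = 2 * k - t"
    have k: "t = k + Suc m" "k = Suc m + r" using 3 by (auto simp: m_def r_def)
    have w: "(Bot # replicate m (Sym 0)) @ [Sym 0] @ (replicate r (Sym 0) @ [Top])
        \<in> stack_words sqrt_nesa"
      using stack_words_sqrt_nesa[of "m + 1 + r"] by (simp add: replicate_add replicate_app_Cons_same)
    have c: "phase_conf k t u = (1, u, (Bot # replicate m (Sym 0)) @ [Sym 0], replicate r (Sym 0) @ [Top])"
      unfolding phase_conf_def k by (simp add: replicate_append_same)
    show ?thesis
      unfolding c step[OF w]
      \<comment> \<open>With \<open>r = 0\<close> the next symbol to the right is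
        \<open>Top\<close>, and the walk up ends.\<close>
      by (cases r) (auto simp: sqrt_rules_def phase_conf_def k replicate_app_Cons_same
          simp del: in_lists_conv_set)
  next
    case 4
    have w: "(Bot # replicate k (Sym 0)) @ [Top] @ [] \<in> stack_words sqrt_nesa"
      by simp
    have c: "phase_conf k t u = (1, u, (Bot # replicate k (Sym 0)) @ [Top], [])"
      unfolding phase_conf_def using 4 by simp
    show ?thesis
      unfolding c step[OF w] using 4
      by (auto simp: sqrt_rules_def phase_conf_def)
  next
    case 5
    have w: "[] @ [Bot] @ [Top] \<in> stack_words sqrt_nesa"
      using stack_words_sqrt_nesa[of 0] by simp
    have c: "phase_conf k t u = (2, u, [] @ [Bot], [Top])"
      unfolding phase_conf_def using 5 by simp
    show ?thesis
      unfolding c step[OF w] using 5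
      by (auto simp: sqrt_rules_def phase_conf_def)
  next
    case 6
    then obtain m where m: "k = Suc m" using gr0_implies_Suc by blast
    have w: "(Bot # replicate m (Sym 0)) @ [Sym 0] @ [Top] \<in> stack_words sqrt_nesa"
      using stack_words_sqrt_nesa[of k] unfolding m snoc by simp
    have c: "phase_conf k t u = (2, u, (Bot # replicate m (Sym 0)) @ [Sym 0], [Top])"
      unfolding phase_conf_def using 6 by (simp add: m replicate_append_same)
    show ?thesis
      unfolding c step[OF w] using 6
      by (auto simp: sqrt_rules_def phase_conf_def m replicate_app_Cons_same
          simp del: in_lists_conv_set)
  qed
qed

lemma stack_size_phase_conf:
  "t \<le> 2 * k + 2 \<Longrightarrow> stack_size (phase_conf k t u) = k"
  by (auto simp: phase_conf_def)

section \<open>Arithmetic of the phases\<close>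

definition level :: "nat \<Rightarrow> nat" where
  "level n = floor_sqrt (Suc n) - 1"

text \<open>The number of letters already read in the current phase. The subtraction never
  truncates, since \<open>Suc (level n)\<close> is the integer square root of
  \<open>Suc n\<close>.\<close>

definition offset :: "nat \<Rightarrow> nat" where
  "offset n = Suc n - (Suc (level n))\<^sup>2"

lemma Suc_level: "Suc (level n) = floor_sqrt (Suc n)"
  using floor_sqrt_greater_zero_iff[of "Suc n"] by (simp add: level_def)

lemma level_offset: "Suc n = (Suc (level n))\<^sup>2 + offset n"
  unfolding offset_def Suc_level by simp

lemma offset_le: "offset n \<le> 2 * level n + 2"
  using level_offset[of n] Suc_floor_sqrt_power2_gt[of "Suc n"]
  unfolding Suc_level[symmetric] by (simp add: power2_eq_square)

text \<open>The bound on \<open>t\<close> keeps \<open>Suc n\<close> below the next square, as (k +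
  2)^2 = (k + 1)^2 + 2k + 3.\<close>

lemma level_unique:
  assumes "Suc n = (Suc k)\<^sup>2 + t" "t \<le> 2 * k + 2"
  shows "level n = k \<and> offset n = t"
proof -
  have "floor_sqrt (Suc n) = Suc k"
    by (rule floor_sqrt_unique) (use assms in \<open>auto simp: power2_eq_square\<close>)
  then have "level n = k" by (simp add: level_def)
  with assms(1) show ?thesis by (simp add: offset_def)
qed

text \<open>The pair changes exactly as the arguments of \<open>phase_conf\<close> do in
  \<open>step_phase_conf\<close>: the offset overflows when a symbol is pushed.\<close>

lemma level_Suc:
  "(level (Suc n), offset (Suc n)) =
     (if offset n = 2 * level n + 2 then (Suc (level n), 0) else (level n, Suc (offset n)))"
proof (cases "offset n = 2 * level n + 2")
  case True
  have "level (Suc n) = Suc (level n) \<and> offset (Suc n) = 0"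
    by (rule level_unique) (use True level_offset[of n] in \<open>auto simp: power2_eq_square\<close>)
  with True show ?thesis by simp
next
  case False
  have "level (Suc n) = level n \<and> offset (Suc n) = Suc (offset n)"
    by (rule level_unique) (use False level_offset[of n] offset_le[of n] in auto)
  with False show ?thesis by simp
qed

lemma mono_level: "mono level"
  unfolding level_def by (intro monoI diff_le_mono mono_floor_sqrt') simp

definition square_letter :: "nat \<Rightarrow> nat" where
  "square_letter n = (if offset n = 2 * level n + 2 then 1 else 0)"

lemma square_letter_eq_1_iff: "square_letter n = 1 \<longleftrightarrow> (\<exists>k. n + 2 = k\<^sup>2)"
proof
  assume "square_letter n = 1"
  then have "offset n = 2 * level n + 2" by (simp add: square_letter_def split: if_splits)
  with level_offset[of n] have "n + 2 = (level n + 2)\<^sup>2" by (simp add: power2_eq_square)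
  then show "\<exists>k. n + 2 = k\<^sup>2" ..
next
  assume "\<exists>k. n + 2 = k\<^sup>2"
  then obtain k where k: "n + 2 = k\<^sup>2" ..
  \<comment> \<open>The squares 0 and 1 are too small to be \<open>n + 2\<close>, so
    \<open>k = j + 2\<close>, and the push happens at level \<open>j\<close>.\<close>
  then have "k \<noteq> 0" "k \<noteq> 1" by (intro notI; simp)+
  then have "\<not> k < 2" by (simp add: less_2_cases_iff)
  then obtain j where j: "k = j + 2" by (metis add.commute le_Suc_ex not_less)
  have "level n = j \<and> offset n = 2 * j + 2"
    by (rule level_unique) (use k j in \<open>auto simp: power2_eq_square\<close>)
  then show "square_letter n = 1" by (simp add: square_letter_def)
qed

section \<open>Runs, indexed by the number of letters read\<close>

definition conf_at :: "nat \<Rightarrow> nat list \<Rightarrow> (nat, nat, nat) config" where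
  "conf_at n u = phase_conf (level n) (offset n) u"

lemma step_conf_at:
  "step sqrt_nesa (conf_at n u) d \<longleftrightarrow>
    (\<exists>v. u = square_letter n # v \<and> v \<in> lists {0, 1} \<and> d = conf_at (Suc n) v)"
  using level_Suc[of n] unfolding conf_at_def square_letter_def step_phase_conf[OF offset_le]
  by (auto split: if_splits)

lemma conf_at_simps [simp]:
  "stack_size (conf_at n u) = level n" "fst (snd (conf_at n u)) = u"
  "fst (conf_at n u) \<in> finals sqrt_nesa"
  unfolding conf_at_def by (simp add: stack_size_phase_conf[OF offset_le])
    (auto simp: phase_conf_def)

lemma conf_at_0: "conf_at 0 u = (0, u, [Bot], [Top])"
proof -
  have "level 0 = 0 \<and> offset 0 = 0" by (rule level_unique) auto
  then show ?thesis by (simp add: conf_at_def phase_conf_def)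
qed

text \<open>\<open>m\<close> counts moves, so the list has \<open>m + 1\<close> entries. As
  \<open>tl\<close> is total, it is a genuine run only if \<open>u\<close> is long enough and
  carries the forced letters.\<close>

fun trace :: "nat \<Rightarrow> nat list \<Rightarrow> nat \<Rightarrow> (nat, nat, nat) config list" where
  "trace n u 0 = [conf_at n u]"
| "trace n u (Suc m) = conf_at n u # trace (Suc n) (tl u) m"

lemma trace_simps [simp]:
  "trace n u m \<noteq> []" "hd (trace n u m) = conf_at n u"
  "last (trace n u m) = conf_at (n + m) (drop m u)"
  "stack_size ` set (trace n u m) = level ` {n..n + m}"
proof -
  show *: "trace n u m \<noteq> []" "hd (trace n u m) = conf_at n u" for n u m
    by (cases m; simp)+
  show "last (trace n u m) = conf_at (n + m) (drop m u)"
    by (induction n u m rule: trace.induct) (auto simp: * drop_Suc)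
  show "stack_size ` set (trace n u m) = level ` {n..n + m}"
    by (induction n u m rule: trace.induct) (auto simp: atLeastAtMost_insertL[symmetric] simp del: atLeastAtMost_insertL)
qed

lemma successively_trace:
  assumes "u \<in> lists {0, 1}" "m \<le> length u" "take m u = map square_letter [n..<n + m]"
  shows "successively (step sqrt_nesa) (trace n u m)"
  using assms
proof (induction n u m rule: trace.induct)
  case (2 n u m)
  then obtain a v where u: "u = a # v" by (cases u) auto
  with "2.prems" have "a = square_letter n" "take m v = map square_letter [Suc n..<Suc n + m]"
    by (auto simp: upt_conv_Cons simp del: upt_Suc)
  with 2 u show ?case by (auto simp: successively_Cons step_conf_at)
qed simp

text \<open>Determinism: each move is forced by \<open>step_conf_at\<close>. The induction
  generalizes \<open>n\<close> and \<open>u\<close> because the tail of a run starts one letter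
  later.\<close>

lemma successively_imp_trace:
  assumes "successively (step sqrt_nesa) C" "C \<noteq> []" "hd C = conf_at n u"
  shows "\<exists>m \<le> length u. C = trace n u m \<and> take m u = map square_letter [n..<n + m]"
  using assms
proof (induction C arbitrary: n u)
  case (Cons c C)
  show ?case
  proof (cases "C = []")
    case True
    with Cons.prems show ?thesis by (intro exI[of _ 0]) auto
  next
    case False
    with Cons.prems have "step sqrt_nesa (conf_at n u) (hd C)" "successively (step sqrt_nesa) C"
      by (auto simp: successively_Cons)
    then obtain v where v: "u = square_letter n # v" "hd C = conf_at (Suc n) v"
      by (auto simp: step_conf_at)
    with Cons.IH False \<open>successively _ C\<close> obtain m where
      "m \<le> length v" "C = trace (Suc n) v m" "take m v = map square_letter [Suc n..<Suc n + m]"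
      by blast
    with v Cons.prems show ?thesis
      by (intro exI[of _ "Suc m"]) (auto simp: upt_conv_Cons simp del: upt_Suc)
  qed
qed simp

lemma partial_computation_sqrt_nesa:
  "partial_computation sqrt_nesa u C \<longleftrightarrow> u \<in> lists {0, 1} \<and>
     (\<exists>m \<le> length u. C = trace 0 u m \<and> take m u = map square_letter [0..<m])"
  using successively_imp_trace[of C 0 u] successively_trace[of u _ 0]
  unfolding partial_computation_def by (auto simp: conf_at_0)

definition square_word :: "nat \<Rightarrow> nat list" where
  "square_word n = map square_letter [0..<n]"

lemma square_word_simps [simp]:
  "length (square_word n) = n" "square_word n \<in> lists {0, 1}"
  by (auto simp: square_word_def square_letter_def)

text \<open>All states are final, so accepting only means consuming the input; this forces
  \<open>m = length u\<close> in \<open>partial_computation_sqrt_nesa\<close>.\<close>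

lemma accepting_computation_sqrt_nesa:
  "accepting_computation sqrt_nesa u C \<longleftrightarrow>
     u = square_word (length u) \<and> C = trace 0 u (length u)"
proof
  assume "accepting_computation sqrt_nesa u C"
  then obtain m where "m \<le> length u" "C = trace 0 u m" "take m u = square_word m" "drop m u = []"
    unfolding accepting_computation_def computation_def partial_computation_sqrt_nesa
    by (auto simp: square_word_def simp del: drop_eq_Nil)
  then show "u = square_word (length u) \<and> C = trace 0 u (length u)" by simp
next
  assume *: "u = square_word (length u) \<and> C = trace 0 u (length u)"
  then have "u \<in> lists {0, 1}" using square_word_simps(2) by metis
  with * have "partial_computation sqrt_nesa u C"
    unfolding partial_computation_sqrt_nesa square_word_def by (metis order_refl take_all_iff)
  moreover have "last C = conf_at (length u) []" using * by simp
  ultimately show "accepting_computation sqrt_nesa u C"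
    unfolding accepting_computation_def computation_def by (metis conf_at_simps(2,3))
qed

lemma language_sqrt_nesa: "language sqrt_nesa = range square_word"
proof (intro equalityI subsetI)
  fix u assume "u \<in> language sqrt_nesa"
  then show "u \<in> range square_word"
    unfolding language_def accepting_computation_sqrt_nesa by blast
next
  fix u assume "u \<in> range square_word"
  then obtain n where "u = square_word n" by blast
  then show "u \<in> language sqrt_nesa"
    unfolding language_def accepting_computation_sqrt_nesa using square_word_simps[of n] by simp
qed

section \<open>The three space measures and their growth\<close>

lemma computation_size_trace: "computation_size (trace 0 u m) = level m"
  unfolding computation_size_def trace_simps
  by (rule Max_eqI) (auto intro: monoD[OF mono_level])

text \<open>An accepted word has a single accepting computation, so infimum and supremum range over
  a singleton.\<close>

lemma accepted_space_sqrt_nesa: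
  "weak_space_word sqrt_nesa u = (if u \<in> language sqrt_nesa then level (length u) else 0)"
  "accept_space_word sqrt_nesa u = (if u \<in> language sqrt_nesa then level (length u) else 0)"
proof -
  have "{C. accepting_computation sqrt_nesa u C} = {trace 0 u (length u)}"
    if "u \<in> language sqrt_nesa"
    using that unfolding accepting_computation_sqrt_nesa language_sqrt_nesa by auto
  then show
    "weak_space_word sqrt_nesa u = (if u \<in> language sqrt_nesa then level (length u) else 0)"
    "accept_space_word sqrt_nesa u = (if u \<in> language sqrt_nesa then level (length u) else 0)"
    unfolding weak_space_word_def accept_space_word_def
    by (simp_all add: computation_size_trace zero_enat_def)
qed

text \<open>On other words the run gets stuck early, which only lowers the level by
  monotonicity.\<close>

lemma strong_space_word_le: "strong_space_word sqrt_nesa u \<le> level (length u)"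
  unfolding strong_space_word_def
  by (auto intro!: SUP_least monoD[OF mono_level]
      simp: partial_computation_sqrt_nesa computation_size_trace)

lemma strong_space_word_square_word: "strong_space_word sqrt_nesa (square_word n) = level n"
proof (rule antisym)
  have "partial_computation sqrt_nesa (square_word n) (trace 0 (square_word n) n)"
    unfolding partial_computation_sqrt_nesa by (auto simp: square_word_def square_letter_def)
  then show "enat (level n) \<le> strong_space_word sqrt_nesa (square_word n)"
    unfolding strong_space_word_def by (intro SUP_upper2) (auto simp: computation_size_trace)
qed (use strong_space_word_le[of "square_word n"] in simp)

text \<open>Every length \<open>n\<close> has the accepted word \<open>square_word n\<close>, which
  attains the upper bound; this serves all three measures.\<close>

lemma max_over_length_sqrt_nesa:
  assumes "\<And>u. s u \<le> enat (level (length u))" "\<And>n. s (square_word n) = enat (level n)"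
  shows "max_over_length sqrt_nesa s n = enat (level n)"
  unfolding max_over_length_def
proof (rule antisym)
  show "enat (level n) \<le> (SUP u \<in> {u \<in> lists (input_alphabet sqrt_nesa). length u = n}. s u)"
    by (rule SUP_upper2[of "square_word n"]) (use assms(2) square_word_simps in auto)
qed (use assms(1) in \<open>auto intro!: SUP_least\<close>)

lemma space_sqrt_nesa:
  "weak_space sqrt_nesa n = level n" "accept_space sqrt_nesa n = level n"
  "strong_space sqrt_nesa n = level n"
  unfolding weak_space_def accept_space_def strong_space_def
  by (rule max_over_length_sqrt_nesa;
      simp add: accepted_space_sqrt_nesa language_sqrt_nesa strong_space_word_le
        strong_space_word_square_word zero_enat_def[symmetric])+

lemma level_bigtheta: "(\<lambda>n. real (level n)) \<in> \<Theta>(\<lambda>n. sqrt (real n))"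
proof (rule bigthetaI'[of "1 / 3" 1])
  show "\<forall>\<^sub>F n in at_top. 1 / 3 * norm (sqrt (real n)) \<le> norm (real (level n)) \<and>
      norm (real (level n)) \<le> 1 * norm (sqrt (real n))"
    \<comment> \<open>From 3 on the level is at least 1, so that sqrt n is at most
      \<open>level n + 2\<close>, hence at most \<open>3 * level n\<close>.\<close>
    using eventually_ge_at_top[of 3]
  proof eventually_elim
    case (elim n)
    have n: "n = level n * level n + 2 * level n + offset n"
      using level_offset[of n] unfolding power2_eq_square mult_Suc mult_Suc_right by linarith
    then have "(level n)\<^sup>2 \<le> n" unfolding power2_eq_square by linarith
    then have "real (level n) \<le> sqrt (real n)"
      by (intro real_le_rsqrt) (metis of_nat_le_iff of_nat_power)
    have "level 3 = 1 \<and> offset 3 = 0" by (rule level_unique) (auto simp: power2_eq_square)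
    with elim have "1 \<le> level n" using monoD[OF mono_level, of 3 n] by simp
    have "n \<le> (level n + 2)\<^sup>2"
      using n offset_le[of n]
      unfolding power2_eq_square add_mult_distrib add_mult_distrib2 by linarith
    also have "\<dots> \<le> (3 * level n)\<^sup>2"
      using \<open>1 \<le> level n\<close> by (intro power_mono) auto
    finally have "real n \<le> (3 * real (level n))\<^sup>2"
      by (metis of_nat_le_iff of_nat_mult of_nat_numeral of_nat_power)
    then have "sqrt (real n) \<le> 3 * real (level n)"
      by (intro real_le_lsqrt) auto
    with \<open>real (level n) \<le> sqrt (real n)\<close> show ?case by simp
  qed
qed auto

section \<open>Non-regularity\<close>

text \<open>
  The state reached after the prefix of length \<open>n\<close> determines the only letter that keeps the
  automaton accepting, so a repeated state makes the infinite word ultimately periodic.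
\<close>

lemma not_regular_range_square_word: "\<not> regular_language {0, 1} (range square_word)"
proof
  assume "regular_language {0, 1} (range square_word)"
  then obtain Q :: "nat set" and d q0 F where fin: "finite Q" and q0: "q0 \<in> Q"
    and "F \<subseteq> Q" and d: "\<forall>q \<in> Q. \<forall>a \<in> {0, 1}. d q a \<in> Q"
    and L: "range square_word = {w \<in> lists {0, 1}. foldl d q0 w \<in> F}"
    unfolding regular_language_def by (elim exE conjE) (rule that)
  define st where "st n = foldl d q0 (square_word n)" for n
  have st_Suc: "st (Suc n) = d (st n) (square_letter n)" for n
    by (simp add: st_def square_word_def)
  have in01: "square_letter n \<in> {0, 1}" for n by (simp add: square_letter_def)
  have "st n \<in> Q" for n
  proof (induction n)
    case 0
    show ?case by (simp add: st_def square_word_def q0)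
  next
    case (Suc n)
    show ?case unfolding st_Suc using d Suc in01 by blast
  qed
  then have "finite (range st)" using fin by (meson finite_subset image_subsetI)
  then have "\<not> inj st" using finite_imageD infinite_UNIV_nat by blast
  then obtain m p where p: "p > 0" "st m = st (m + p)"
    by (metis injI linorder_neqE_nat less_imp_add_positive)
  have letter: "a = square_letter n \<longleftrightarrow> d (st n) a \<in> F" if "a \<in> {0, 1}" for a n
  proof -
    have "foldl d q0 (square_word n @ [a]) = d (st n) a" by (simp add: st_def)
    moreover have "square_word n @ [a] \<in> lists {0, 1}"
      using that square_word_simps(2)[of n] by auto
    ultimately have "d (st n) a \<in> F \<longleftrightarrow> square_word n @ [a] \<in> range square_word"
      unfolding L by simp
    also have "\<dots> \<longleftrightarrow> a = square_letter n"
    proof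
      assume "square_word n @ [a] \<in> range square_word"
      then obtain k where k: "square_word n @ [a] = square_word k" by blast
      then have "k = Suc n" by (metis length_append_singleton square_word_simps(1))
      with k show "a = square_letter n" by (simp add: square_word_def)
    next
      assume "a = square_letter n"
      then have "square_word n @ [a] = square_word (Suc n)" by (simp add: square_word_def)
      then show "square_word n @ [a] \<in> range square_word" by blast
    qed
    finally show ?thesis by blast
  qed
  \<comment> \<open>The forced letter at \<open>i\<close> leads from the common state into
    \<open>F\<close>, so it is the forced letter at \<open>j\<close> too.\<close>
  have letters: "square_letter i = square_letter j" if "st i = st j" for i j
    using letter[OF in01, of i j] letter[OF in01, of i i] that by metis
  have per: "st (m + i) = st (m + p + i)" for i
  proof (induction i)
    case (Suc i)
    show ?case using letters[OF Suc] Suc unfolding add_Suc_right st_Suc by metis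
  qed (use p in simp)
  \<comment> \<open>This choice puts the square \<open>k\<^sup>2\<close> into the periodic part and
    makes the gap \<open>2 * k + 1\<close> to the next square exceed the period \<open>p\<close>.
    Shifting by \<open>p\<close> then yields a square strictly between consecutive squares.\<close>
  define k where "k = m + p + 2"
  have "m + 2 \<le> k\<^sup>2" by (simp add: k_def power2_eq_square)
  then obtain i where "k\<^sup>2 = m + 2 + i" using le_Suc_ex by blast
  then have i: "m + i + 2 = k\<^sup>2" by simp
  then have "square_letter (m + i) = 1" using square_letter_eq_1_iff by blast
  then have "square_letter (m + p + i) = 1" using letters[OF per[of i]] by metis
  then obtain j where "m + p + i + 2 = j\<^sup>2" using square_letter_eq_1_iff by blast
  with i have "k\<^sup>2 + p = j\<^sup>2" by linarith
  then have "k\<^sup>2 < j\<^sup>2" using p by linarith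
  then have "k < j" by (rule power2_less_imp_less) simp
  then have "(Suc k)\<^sup>2 \<le> j\<^sup>2" by (intro power_mono) auto
  with \<open>k\<^sup>2 + p = j\<^sup>2\<close> have "(Suc k)\<^sup>2 \<le> k\<^sup>2 + p" by metis
  then have "2 * k + 1 \<le> p" unfolding power2_eq_square mult_Suc mult_Suc_right by linarith
  then show False by (simp add: k_def)
qed

theorem proposition10:
  shows "\<exists>M :: (nat, nat, nat) stack_automaton.
           NESA M \<and>
           \<not> regular_language (input_alphabet M) (language M) \<and>
           space_in_bigtheta (weak_space M) (\<lambda>n. sqrt (real n)) \<and>
           space_in_bigtheta (accept_space M) (\<lambda>n. sqrt (real n)) \<and>
           space_in_bigtheta (strong_space M) (\<lambda>n. sqrt (real n))"
  using NESA_sqrt_nesa not_regular_range_square_word level_bigtheta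
  by (intro exI[of _ sqrt_nesa])
    (simp add: language_sqrt_nesa space_in_bigtheta_def space_sqrt_nesa)

end
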